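(* Let $A\in\mathbb{R}^{m\times n}$ have full column rank, let $b\in\mathbb{R}^m$, and let $\{W_k\}_{k\ge 1}$ be an i.i.d. sequence of random $m\times\ell$ matrices, uniformly distributed on $\{W^{(1)},\dots,W^{(M)}\}$, with $\mathbb{E}\,W_kW_k^\top=\beta I$ for some $\beta>0$. Put $A_k=W_k^\top A$ and $b_k=W_k^\top b$. For an arbitrary initial vector $x_0\in\mathbb{R}^n$ and damping parameter $\alpha>0$, define for $k\ge 1$ $$x_k=x_{k-1}-B_k(\alpha)\,A_k^\top\left(A_kx_{k-1}-b_k\right),\qquad B_k(\alpha)=\alpha\left(I+\alpha A_k^\top A_k\right)^{-1}.$$ Let $B=\mathbb{E}\,B_k(\alpha)A_k^\top A_k$ and $\widehat{x}=B^{-1}\,\mathbb{E}\,B_k(\alpha)A_k^\top b_k$. Then: (i) $\mathbb{E}\,x_k\to\widehat{x}$ as $k\to\infty$; more precisely, $$\left\|\mathbb{E}\,x_k-\widehat{x}\right\|_2\le\rho^k\left\|x_0-\widehat{x}\right\|_2,\qquad\text{where }\rho=\left\|\mathbb{E}\,B_k(\alpha)/\alpha\right\|_2<1.$$ (ii) The $L^2$-error around $\widehat{x}$ is bounded by $$\mathbb{E}\left\|x_k-\widehat{x}\right\|_2^2\le(1-2c)^k\left\|x_0-\widehat{x}\right\|_2^2+\alpha^2c^{-1}\sigma^2,$$ where $0<1-2c<1$, with $c=\lambda_{\min}(B)/(1+\alpha A_{\max})$ and $\sigma^2=\mathbb{E}\left\|A_k^\top(A_k\widehat{x}-b_k)\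right\|_2^2$.
   Context: $W^{(1)},\dots,W^{(M)}$ are fixed $m\times\ell$ real matrices. $\lambda_{\min}(\cdot)$ and $\lambda_{\max}(\cdot)$ denote the smallest and largest eigenvalues of a symmetric matrix, and $\|\cdot\|_2$ is the Euclidean norm of a vector or the spectral norm of a matrix. $A_{\max}=\max_{1\le i\le M}\lambda_{\max}\left(A^\top W^{(i)}(W^{(i)})^\top A\right)$. All expectations are with respect to the joint distribution of the sequence $\{W_k\}$, with $b$ (hence the noise in it) held fixed. Since the $W_k$ are identically distributed, $\mathbb{E}\,B_k(\alpha)$, $B$, $\widehat{x}$ and $\sigma^2$ do not depend on $k$; one has $B=I-\mathbb{E}\,B_k(\alpha)/\alpha$, and when $A$ has full column rank $B$ is symmetric positive definite, so $\widehat{x}$ is well defined; it equals $\operatorname{argmin}_x\|Bx-\mathbb{E}\,B_k(\alpha)A_k^\top b_k\|_2^2$. *)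

theory Defs
  imports "HOL-Probability.Probability"
begin

text \<open>The minimum and maximum below are meaningful for symmetric matrices, whose eigenvalues form
  a finite nonempty set of reals.\<close>

definition eigenvalues :: "real^'n^'n \<Rightarrow> real set" where
  "eigenvalues C = {lam. \<exists>v. v \<noteq> 0 \<and> C *v v = lam *\<^sub>R v}"

definition lambda_min :: "real^'n^'n \<Rightarrow> real" where
  "lambda_min C = Min (eigenvalues C)"

definition lambda_max :: "real^'n^'n \<Rightarrow> real" where
  "lambda_max C = Max (eigenvalues C)"

text \<open>The norm of the type \<^typ>\<open>real^'n^'m\<close> is the Frobenius norm, hence \<^const>\<open>onorm\<close> here.\<close>

definition spectral_norm :: "real^'n^'m \<Rightarrow> real" where
  "spectral_norm C = onorm (\<lambda>v. C *v v)"

definition A_max :: "real^'n^'m \<Rightarrow> (nat \<Rightarrow> real^'l^'m) \<Rightarrow> nat \<Rightarrow> real" where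
  "A_max A W M = Max ((\<lambda>i. lambda_max (transpose A ** W i ** transpose (W i) ** A)) ` {1..M})"

definition sketch_mat :: "real^'n^'m \<Rightarrow> real^'l^'m \<Rightarrow> real^'n^'l" where
  "sketch_mat A V = transpose V ** A"

definition sketch_vec :: "real^'m \<Rightarrow> real^'l^'m \<Rightarrow> real^'l" where
  "sketch_vec b V = transpose V *v b"

definition damped_inv :: "real \<Rightarrow> real^'n^'m \<Rightarrow> real^'l^'m \<Rightarrow> real^'n^'n" where
  "damped_inv \<alpha> A V =
     \<alpha> *\<^sub>R matrix_inv (mat 1 + \<alpha> *\<^sub>R (transpose (sketch_mat A V) ** sketch_mat A V))"

text \<open>In \<open>iterate\<close> the argument \<open>V\<close> is one realisation of the sketching sequence;
  \<open>V 0\<close> is not used.\<close>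

primrec iterate ::
  "real^'n^'m \<Rightarrow> real^'m \<Rightarrow> real \<Rightarrow> real^'n \<Rightarrow> (nat \<Rightarrow> real^'l^'m) \<Rightarrow> nat \<Rightarrow> real^'n" where
  "iterate A b \<alpha> x\<^sub>0 V 0 = x\<^sub>0"
| "iterate A b \<alpha> x\<^sub>0 V (Suc k) =
     iterate A b \<alpha> x\<^sub>0 V k - damped_inv \<alpha> A (V (Suc k)) *v
       (transpose (sketch_mat A (V (Suc k))) *v
         (sketch_mat A (V (Suc k)) *v iterate A b \<alpha> x\<^sub>0 V k - sketch_vec b (V (Suc k))))"

text \<open>In the remaining definitions \<open>V\<close> is a random sketching matrix on the probability space \<open>P\<close>.\<close>

definition mean_damped_inv ::
  "'w measure \<Rightarrow> real \<Rightarrow> real^'n^'m \<Rightarrow> ('w \<Rightarrow> real^'l^'m) \<Rightarrow> real^'n^'n" where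
  "mean_damped_inv P \<alpha> A V = (\<integral>\<omega>. damped_inv \<alpha> A (V \<omega>) \<partial>P)"

definition mean_B ::
  "'w measure \<Rightarrow> real \<Rightarrow> real^'n^'m \<Rightarrow> ('w \<Rightarrow> real^'l^'m) \<Rightarrow> real^'n^'n" where
  "mean_B P \<alpha> A V =
     (\<integral>\<omega>. damped_inv \<alpha> A (V \<omega>) ** transpose (sketch_mat A (V \<omega>)) ** sketch_mat A (V \<omega>) \<partial>P)"

definition x_hat ::
  "'w measure \<Rightarrow> real \<Rightarrow> real^'n^'m \<Rightarrow> real^'m \<Rightarrow> ('w \<Rightarrow> real^'l^'m) \<Rightarrow> real^'n" where
  "x_hat P \<alpha> A b V =
     matrix_inv (mean_B P \<alpha> A V) *v
       (\<integral>\<omega>. damped_inv \<alpha> A (V \<omega>) *v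
              (transpose (sketch_mat A (V \<omega>)) *v sketch_vec b (V \<omega>)) \<partial>P)"

definition sigma_sq ::
  "'w measure \<Rightarrow> real \<Rightarrow> real^'n^'m \<Rightarrow> real^'m \<Rightarrow> ('w \<Rightarrow> real^'l^'m) \<Rightarrow> real" where
  "sigma_sq P \<alpha> A b V =
     (\<integral>\<omega>. (norm (transpose (sketch_mat A (V \<omega>)) *v
              (sketch_mat A (V \<omega>) *v x_hat P \<alpha> A b V - sketch_vec b (V \<omega>))))\<^sup>2 \<partial>P)"

end

theory Submission
  imports Defs
begin

text \<open>
  Fix a sample \<open>W i\<close>, let \<open>K = (W i)\<^sup>T A\<close>, and let \<open>R = (I + \<alpha> K\<^sup>T K)\<^sup>-\<^sup>1\<close> be the resolvent of its Gram
  matrix, so that the damped inverse is \<open>\<alpha> R\<close> and \<open>\<alpha> R K\<^sup>T K = I - R\<close>. One step of the iteration then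
  maps the error \<open>e\<close> about the limit point \<open>xh\<close> to \<open>R e - \<alpha> R r\<close>, where \<open>r\<close> is the residual of the sketched
  normal equations at \<open>xh\<close> (lemma \<open>update_error\<close>). The definition of \<open>xh\<close> says exactly that \<open>R r\<close> has mean
  zero (lemma \<open>residual_unbiased\<close>).

  The current iterate depends on earlier samples only and is therefore independent of the next
  sample. Taking expectations, the mean error is multiplied in each step by the mean resolvent
  \<open>E R = I - B\<close>. Resolvents are firmly nonexpansive, a property stable under averaging, whence
  \<open>|E R v|\<^sup>2 \<le> v \<bullet> E R v = |v|\<^sup>2 - v \<bullet> B v\<close>. As \<open>A\<close> has full column rank and the samples are isotropic on
  average, \<open>B\<close> is positive definite, so \<open>E R\<close> is a strict contraction (lemma
  \<open>mean_resolvent_contraction\<close>). This gives the statement about the mean.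

  For the mean square error, put \<open>G = I - R\<close>. Expanding \<open>|e - (G e + \<alpha> R r)|\<^sup>2\<close>, the cross term between
  \<open>e\<close> and the noise has mean zero, and \<open>|G e + \<alpha> R r|\<^sup>2 \<le> 2 |G e|\<^sup>2 + 2 \<alpha>\<^sup>2 |r|\<^sup>2\<close>. Since the eigenvalues of
  \<open>K\<^sup>T K\<close> are at most \<open>A_max\<close>, one has \<open>|G e|\<^sup>2 \<le> \<alpha> A_max / (1 + \<alpha> A_max) (e \<bullet> G e)\<close>, and part of the descent
  term \<open>- 2 e \<bullet> G e\<close> survives. The outcome is a recursion with factor \<open>1 - 2 c\<close> and inhomogeneity
  \<open>2 \<alpha>\<^sup>2 \<sigma>\<^sup>2\<close> (lemma \<open>mean_square_step\<close>), whose fixed point is \<open>\<alpha>\<^sup>2 \<sigma>\<^sup>2 / c\<close>.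

  All distributions are finitely supported, so expectations over one sample are plain averages. The
  measure theory is confined to two points: the update is continuous, hence measurable, in the
  sample and the iterate; and a sample and an independent iterate can be integrated one after the
  other (lemma \<open>indep_uniform_sample\<close>).
\<close>

section \<open>Extreme eigenvalues of symmetric matrices\<close>

lemma inner_matrix_transpose:
  fixes C :: "real^'n^'m"
  shows "x \<bullet> (transpose C *v y) = (C *v x) \<bullet> y"
  by (metis dot_lmul_matrix inner_commute transpose_matrix_vector)

lemma linear_mult_self_adjoint:
  fixes C :: "real^'n^'n"
  assumes "transpose C = C"
  shows "x \<bullet> (C *v y) = (C *v x) \<bullet> y"
  using inner_matrix_transpose[of x C y] assms by simp

text \<open>Eigenvectors of a symmetric matrix for distinct eigenvalues are orthogonal, hence linearly
  independent, and there are at most \<open>n\<close> of them. Finiteness is what gives the \<^const>\<open>Min\<close> and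
  \<^const>\<open>Max\<close> in the definitions of \<^const>\<open>lambda_min\<close> and \<^const>\<open>lambda_max\<close> their meaning.\<close>

lemma finite_eigenvalues:
  fixes C :: "real^'n^'n"
  assumes sym: "transpose C = C"
  shows "finite (eigenvalues C)"
proof -
  have "\<forall>a\<in>eigenvalues C. \<exists>v. v \<noteq> 0 \<and> C *v v = a *\<^sub>R v"
    by (simp add: eigenvalues_def)
  from bchoice[OF this] obtain f
    where f: "\<And>a. a \<in> eigenvalues C \<Longrightarrow> f a \<noteq> 0 \<and> C *v f a = a *\<^sub>R f a"
    by blast
  have orth: "f a \<bullet> f b = 0" if "a \<in> eigenvalues C" "b \<in> eigenvalues C" "a \<noteq> b" for a b
    using linear_mult_self_adjoint[OF sym, of "f a" "f b"] f that by simp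
  have inj: "inj_on f (eigenvalues C)"
    using orth f by (metis inj_onI inner_eq_zero_iff)
  have "pairwise orthogonal (f ` eigenvalues C)"
    using orth by (auto simp: pairwise_def orthogonal_def)
  then have "independent (f ` eigenvalues C)"
    using f by (intro pairwise_orthogonal_independent) auto
  then show ?thesis
    using inj finite_imageD independent_imp_finite by blast
qed

text \<open>The Rayleigh quotient has a minimum \<open>l\<close> on the compact unit sphere, attained at \<open>v\<close>. The quadratic
  form of \<open>N = C - l I\<close> is then nonnegative and vanishes at \<open>v\<close>. Moving from \<open>v\<close> in the direction
  \<open>N v\<close> changes it at first order by twice the squared length of \<open>N v\<close>, which must therefore be zero.\<close>

lemma rayleigh_minimizer_is_eigenvector:
  fixes C :: "real^'n^'n"
  assumes sym: "transpose C = C"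
  obtains l v where "norm v = 1" "C *v v = l *\<^sub>R v" "\<And>u. l * (norm u)\<^sup>2 \<le> u \<bullet> (C *v u)"
proof -
  have "sphere (0 :: real^'n) 1 \<noteq> {}"
    by (metis empty_iff mem_sphere_0 norm_axis_1)
  moreover have "continuous_on (sphere 0 1) (\<lambda>u. u \<bullet> (C *v u))"
    by (intro continuous_on_inner continuous_on_id matrix_vector_mult_linear_continuous_on)
  ultimately obtain v :: "real^'n" where v: "norm v = 1"
    and min: "\<And>u. norm u = 1 \<Longrightarrow> v \<bullet> (C *v v) \<le> u \<bullet> (C *v u)"
    using continuous_attains_inf[of "sphere (0 :: real^'n) 1" "\<lambda>u. u \<bullet> (C *v u)"]
    by auto
  define l where "l = v \<bullet> (C *v v)"
  have le: "l * (norm u)\<^sup>2 \<le> u \<bullet> (C *v u)" for u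
  proof (cases "u = 0")
    case False
    have "l \<le> (u /\<^sub>R norm u) \<bullet> (C *v (u /\<^sub>R norm u))"
      using False unfolding l_def by (intro min) simp
    also have "\<dots> = (u \<bullet> (C *v u)) / (norm u)\<^sup>2"
      by (simp add: matrix_vector_mult_scaleR power2_eq_square field_simps)
    finally show ?thesis using False by (simp add: field_simps)
  qed simp
  define N where "N u = C *v u - l *\<^sub>R u" for u
  define a where "a = N v \<bullet> N v"
  define q where "q = N v \<bullet> N (N v)"
  have q0: "q \<ge> 0"
    using le[of "N v"] by (simp add: q_def N_def[of "N v"] algebra_simps power2_norm_eq_inner)
  have vv: "v \<bullet> N v = 0"
    using v by (simp add: N_def l_def algebra_simps norm_eq_1)
  have vN: "v \<bullet> N (N v) = a"
    using linear_mult_self_adjoint[OF sym, of v "N v"]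
    by (simp add: a_def N_def[of "N v"] algebra_simps) (simp add: N_def algebra_simps)
  have quad: "0 \<le> 2 * t * a + t\<^sup>2 * q" for t
  proof -
    let ?u = "v + t *\<^sub>R N v"
    have "N ?u = N v + t *\<^sub>R N (N v)"
      by (simp add: N_def matrix_vector_right_distrib matrix_vector_mult_scaleR
          matrix_vector_mult_diff_distrib algebra_simps)
    then have "?u \<bullet> N ?u = 2 * t * a + t\<^sup>2 * q"
      using vv vN by (simp add: inner_add_left inner_add_right a_def q_def power2_eq_square algebra_simps)
    moreover have "0 \<le> ?u \<bullet> N ?u"
      using le[of ?u] by (simp add: N_def inner_diff_right power2_norm_eq_inner)
    ultimately show ?thesis by simp
  qed
  \<comment> \<open>The parabola \<open>2 t a + t\<^sup>2 q\<close> is nonnegative only if its slope at \<open>0\<close> vanishes.\<close>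
  have "0 \<le> 2 * (- a / (q + 1)) * a + (- a / (q + 1))\<^sup>2 * q" by (rule quad)
  also have "\<dots> = - (a\<^sup>2 * (q + 2) / (q + 1)\<^sup>2)"
    using q0 by (simp add: power2_eq_square divide_simps) (simp add: algebra_simps)
  finally have "a = 0"
    using q0 by (simp add: divide_le_0_iff zero_le_mult_iff mult_le_0_iff)
  then have "C *v v = l *\<^sub>R v"
    by (simp add: a_def N_def)
  with v le show ?thesis using that by blast
qed

lemma lambda_min_rayleigh:
  fixes C :: "real^'n^'n"
  assumes sym: "transpose C = C"
  shows "lambda_min C \<in> eigenvalues C" and "lambda_min C * (norm u)\<^sup>2 \<le> u \<bullet> (C *v u)"
proof -
  obtain l v where v: "norm v = 1" "C *v v = l *\<^sub>R v" "\<And>u. l * (norm u)\<^sup>2 \<le> u \<bullet> (C *v u)"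
    using rayleigh_minimizer_is_eigenvector[OF sym] by metis
  have mem: "l \<in> eigenvalues C"
    using v by (auto simp: eigenvalues_def intro!: exI[of _ v])
  then show "lambda_min C \<in> eigenvalues C"
    unfolding lambda_min_def using finite_eigenvalues[OF sym] Min_in by blast
  have "lambda_min C \<le> l"
    unfolding lambda_min_def using finite_eigenvalues[OF sym] mem by simp
  then have "lambda_min C * (norm u)\<^sup>2 \<le> l * (norm u)\<^sup>2"
    by (simp add: mult_right_mono)
  with v(3)[of u] show "lambda_min C * (norm u)\<^sup>2 \<le> u \<bullet> (C *v u)"
    by linarith
qed

text \<open>A minimizer of the Rayleigh quotient of \<open>- C\<close> is a maximizer for \<open>C\<close>.\<close>

lemma lambda_max_rayleigh:
  fixes C :: "real^'n^'n"
  assumes sym: "transpose C = C"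
  shows "u \<bullet> (C *v u) \<le> lambda_max C * (norm u)\<^sup>2"
proof -
  have "transpose (- C) = - C"
    using sym by (simp add: transpose_def vec_eq_iff)
  from rayleigh_minimizer_is_eigenvector[OF this]
  obtain l v where v: "norm v = 1" "(- C) *v v = l *\<^sub>R v"
      "\<And>u. l * (norm u)\<^sup>2 \<le> u \<bullet> ((- C) *v u)" by metis
  have mv: "(- C) *v u = - (C *v u)" for u
    by (simp add: matrix_vector_mult_def vec_eq_iff sum_negf)
  have "C *v v = (- l) *\<^sub>R v"
    using v(2) unfolding mv by (metis minus_minus scaleR_minus_left)
  then have "- l \<in> eigenvalues C"
    using v(1) by (auto simp: eigenvalues_def intro!: exI[of _ v])
  then have "- l \<le> lambda_max C"
    unfolding lambda_max_def using finite_eigenvalues[OF sym] by simp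
  then have "- l * (norm u)\<^sup>2 \<le> lambda_max C * (norm u)\<^sup>2"
    by (rule mult_right_mono) simp
  moreover have "u \<bullet> (C *v u) \<le> - l * (norm u)\<^sup>2"
    using v(3)[of u] unfolding mv by simp
  ultimately show ?thesis by linarith
qed

section \<open>The resolvent of a Gram matrix\<close>

text \<open>The damped inverse of the iteration is \<open>\<alpha>\<close> times this matrix. Working with the resolvent keeps the
  operator nonexpansive and makes \<open>\<alpha>\<close> appear only as an explicit factor.\<close>

definition resolvent :: "real \<Rightarrow> real^'n^'l \<Rightarrow> real^'n^'n" where
  "resolvent \<alpha> K = matrix_inv (mat 1 + \<alpha> *\<^sub>R (transpose K ** K))"

lemma damped_inv_eq_resolvent: "damped_inv \<alpha> A V = \<alpha> *\<^sub>R resolvent \<alpha> (sketch_mat A V)"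
  by (simp add: damped_inv_def resolvent_def)

lemma matrix_inv_of_trivial_kernel:
  fixes C :: "real^'n^'n"
  assumes "\<And>v. C *v v = 0 \<Longrightarrow> v = 0"
  shows "matrix_inv C ** C = mat 1" and "C ** matrix_inv C = mat 1"
proof -
  have "\<exists>B. B ** C = mat 1"
    using assms by (simp add: matrix_left_invertible_ker)
  then have "\<exists>B. C ** B = mat 1 \<and> B ** C = mat 1"
    using matrix_left_right_inverse by blast
  from someI_ex[OF this]
  show "matrix_inv C ** C = mat 1" and "C ** matrix_inv C = mat 1"
    unfolding matrix_inv_def by auto
qed

context
  fixes \<alpha> :: real and K :: "real^'n^'l"
  assumes alpha: "\<alpha> > 0"
begin

lemma damped_gram_apply:
  "(mat 1 + \<alpha> *\<^sub>R (transpose K ** K)) *v v = v + \<alpha> *\<^sub>R (transpose K *v (K *v v))"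
  by (simp add: matrix_vector_mult_add_rdistrib scaleR_matrix_vector_assoc[symmetric]
      matrix_vector_mul_assoc[symmetric] del: transpose_matrix_vector)

text \<open>Pairing \<open>(I + \<alpha> K\<^sup>T K) v = 0\<close> with \<open>v\<close> gives a sum of two nonnegative terms, so the matrix is
  invertible.\<close>

lemma damped_gram_kernel:
  assumes "(mat 1 + \<alpha> *\<^sub>R (transpose K ** K)) *v v = 0"
  shows "v = 0"
proof -
  have "0 = v \<bullet> (v + \<alpha> *\<^sub>R (transpose K *v (K *v v)))"
    using assms unfolding damped_gram_apply by simp
  also have "\<dots> = (norm v)\<^sup>2 + \<alpha> * (norm (K *v v))\<^sup>2"
    by (simp add: inner_add_right inner_matrix_transpose power2_norm_eq_inner
        del: transpose_matrix_vector)
  finally show ?thesis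
    using alpha by (smt (verit) mult_nonneg_nonneg norm_eq_zero zero_le_power2 zero_eq_power2)
qed

lemmas resolvent_inverse = 
  matrix_inv_of_trivial_kernel[of "mat 1 + \<alpha> *\<^sub>R (transpose K ** K)", OF damped_gram_kernel, folded resolvent_def]

text \<open>With \<open>u\<close> the image of \<open>v\<close> under the resolvent, this reads \<open>v = u + \<alpha> K\<^sup>T K u\<close>. Together with
  \<open>resolvent_gram\<close>, its mirror image, it carries every estimate below: no diagonalization of
  \<open>K\<^sup>T K\<close> is required.\<close>

lemma resolvent_decompose:
  "v = resolvent \<alpha> K *v v + \<alpha> *\<^sub>R (transpose K *v (K *v (resolvent \<alpha> K *v v)))"
  by (metis damped_gram_apply matrix_vector_mul_assoc matrix_vector_mul_lid resolvent_inverse(2))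

lemma resolvent_gram:
  "\<alpha> *\<^sub>R (resolvent \<alpha> K *v (transpose K *v (K *v v))) = v - resolvent \<alpha> K *v v"
proof -
  have "v = resolvent \<alpha> K *v (v + \<alpha> *\<^sub>R (transpose K *v (K *v v)))"
    by (metis damped_gram_apply matrix_vector_mul_assoc matrix_vector_mul_lid resolvent_inverse(1))
  then show ?thesis
    by (simp add: matrix_vector_right_distrib matrix_vector_mult_scaleR algebra_simps)
qed

lemma resolvent_symmetric: "transpose (resolvent \<alpha> K) = resolvent \<alpha> K"
proof -
  let ?C = "mat 1 + \<alpha> *\<^sub>R (transpose K ** K)"
  have "transpose ?C = ?C"
    by (simp add: transpose_def matrix_matrix_mult_def mat_def vec_eq_iff mult.commute)
  then have "transpose (resolvent \<alpha> K) ** ?C = mat 1"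
    by (metis matrix_transpose_mul resolvent_inverse(2) transpose_mat)
  then show ?thesis
    by (metis matrix_mul_assoc matrix_mul_lid matrix_mul_rid resolvent_inverse(2))
qed

lemma inner_resolvent:
  "v \<bullet> (resolvent \<alpha> K *v v)
     = (norm (resolvent \<alpha> K *v v))\<^sup>2 + \<alpha> * (norm (K *v (resolvent \<alpha> K *v v)))\<^sup>2"
proof -
  let ?u = "resolvent \<alpha> K *v v"
  have "v \<bullet> ?u = ?u \<bullet> v" by (rule inner_commute)
  also have "\<dots> = ?u \<bullet> (?u + \<alpha> *\<^sub>R (transpose K *v (K *v ?u)))"
    using resolvent_decompose[of v] by simp
  finally show ?thesis
    by (simp add: inner_add_right inner_matrix_transpose power2_norm_eq_inner
        del: transpose_matrix_vector)
qed

text \<open>This is the inequality \<open>|u|\<^sup>2 \<le> v \<bullet> u\<close> for the image \<open>u\<close> of \<open>v\<close> in a form that is convex in \<open>u\<close>.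
  The convex form survives averaging over several resolvents.\<close>

lemma resolvent_firmly_nonexpansive:
  "norm (2 *\<^sub>R (resolvent \<alpha> K *v v) - v) \<le> norm v"
proof -
  have "(norm (2 *\<^sub>R (resolvent \<alpha> K *v v) - v))\<^sup>2
      = 4 * (norm (resolvent \<alpha> K *v v))\<^sup>2 - 4 * (v \<bullet> (resolvent \<alpha> K *v v)) + (norm v)\<^sup>2"
    by (simp only: power2_norm_eq_inner) (simp add: algebra_simps inner_commute)
  also have "\<dots> \<le> (norm v)\<^sup>2"
    using alpha by (simp add: inner_resolvent)
  finally show ?thesis by (simp add: power2_le_iff_abs_le)
qed

lemma resolvent_nonexpansive: "norm (resolvent \<alpha> K *v v) \<le> norm v"
proof -
  have "norm (2 *\<^sub>R (resolvent \<alpha> K *v v)) \<le> norm v + norm v"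
    using resolvent_firmly_nonexpansive[of v] norm_triangle_sub[of "2 *\<^sub>R (resolvent \<alpha> K *v v)" v]
    by linarith
  then show ?thesis by simp
qed

lemma inner_minus_resolvent:
  fixes v :: "real^'n"
  defines "u \<equiv> resolvent \<alpha> K *v v"
  shows "v \<bullet> (v - u) = \<alpha> * (norm (K *v u))\<^sup>2 + (norm (v - u))\<^sup>2"
proof -
  have eq: "v - u = \<alpha> *\<^sub>R (transpose K *v (K *v u))"
    using resolvent_decompose[of v] unfolding u_def by (simp add: algebra_simps)
  have "v \<bullet> (v - u) = u \<bullet> (v - u) + (norm (v - u))\<^sup>2"
    by (simp add: power2_norm_eq_inner algebra_simps)
  also have "u \<bullet> (v - u) = \<alpha> * (norm (K *v u))\<^sup>2"
    unfolding eq by (simp add: inner_matrix_transpose power2_norm_eq_inner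
        del: transpose_matrix_vector)
  finally show ?thesis .
qed

lemma inner_minus_resolvent_nonneg: "0 \<le> v \<bullet> (v - resolvent \<alpha> K *v v)"
  unfolding inner_minus_resolvent using alpha by simp

text \<open>The defect \<open>v \<bullet> (v - u)\<close> controls \<open>K u\<close> and \<open>v - u\<close>; if it vanishes then \<open>u = v\<close> and \<open>K v = 0\<close>. This is
  how full column rank of the system will enter.\<close>

lemma inner_minus_resolvent_eq_0:
  assumes "v \<bullet> (v - resolvent \<alpha> K *v v) = 0"
  shows "K *v v = 0"
proof -
  let ?u = "resolvent \<alpha> K *v v"
  have "\<alpha> * (norm (K *v ?u))\<^sup>2 + (norm (v - ?u))\<^sup>2 = 0"
    using assms unfolding inner_minus_resolvent .
  moreover have "\<alpha> * (norm (K *v ?u))\<^sup>2 \<ge> 0"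
    using alpha by simp
  ultimately have "\<alpha> * (norm (K *v ?u))\<^sup>2 = 0" "(norm (v - ?u))\<^sup>2 = 0"
    using zero_le_power2[of "norm (v - ?u)"] by linarith+
  then show ?thesis using alpha by simp
qed

text \<open>On an eigenvector of \<open>K\<^sup>T K\<close> with eigenvalue \<open>s \<le> L\<close>, the map \<open>v \<mapsto> v - u\<close> multiplies by
  \<open>\<alpha> s / (1 + \<alpha> s)\<close>, which is at most \<open>\<alpha> L / (1 + \<alpha> L)\<close>. Since \<open>v - u = \<alpha> K\<^sup>T K u\<close>, the bound reduces
  to \<open>|K\<^sup>T K u|\<^sup>2 \<le> L |K u|\<^sup>2\<close>, a consequence of the Cauchy-Schwarz inequality.\<close>

lemma norm_minus_resolvent_le:
  assumes L: "\<And>u. (norm (K *v u))\<^sup>2 \<le> L * (norm u)\<^sup>2"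
  shows "(1 + \<alpha> * L) * (norm (v - resolvent \<alpha> K *v v))\<^sup>2
           \<le> \<alpha> * L * (v \<bullet> (v - resolvent \<alpha> K *v v))"
proof -
  let ?u = "resolvent \<alpha> K *v v"
  let ?w = "transpose K *v (K *v ?u)"
  have "(norm ?w)\<^sup>2 = (K *v ?w) \<bullet> (K *v ?u)"
    unfolding power2_norm_eq_inner by (rule inner_matrix_transpose)
  also have "\<dots> \<le> norm (K *v ?w) * norm (K *v ?u)" by (rule norm_cauchy_schwarz)
  finally have "((norm ?w)\<^sup>2)\<^sup>2 \<le> (norm (K *v ?w) * norm (K *v ?u))\<^sup>2"
    by (rule power_mono) simp
  also have "\<dots> \<le> (L * (norm ?w)\<^sup>2) * (norm (K *v ?u))\<^sup>2"
    unfolding power_mult_distrib by (intro mult_right_mono L) simp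
  finally have sq: "(norm ?w)\<^sup>2 * (norm ?w)\<^sup>2 \<le> (L * (norm (K *v ?u))\<^sup>2) * (norm ?w)\<^sup>2"
    by (simp only: power2_eq_square mult_ac)
  have "0 \<le> L"
    using order_trans[OF zero_le_power2 L[of "axis undefined 1"]] by simp
  then have w: "(norm ?w)\<^sup>2 \<le> L * (norm (K *v ?u))\<^sup>2"
  proof (cases "?w = 0")
    case False
    then have "0 < (norm ?w)\<^sup>2" by (simp del: transpose_matrix_vector)
    with sq show ?thesis by (rule mult_right_le_imp_le)
  qed (simp del: transpose_matrix_vector)
  have eq: "v - ?u = \<alpha> *\<^sub>R ?w"
    using resolvent_decompose[of v] by (simp add: algebra_simps)
  have "(norm (v - ?u))\<^sup>2 \<le> \<alpha>\<^sup>2 * (L * (norm (K *v ?u))\<^sup>2)"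
    unfolding eq norm_scaleR power_mult_distrib power2_abs by (rule mult_left_mono[OF w]) simp
  then show ?thesis
    unfolding inner_minus_resolvent by (simp add: algebra_simps power2_eq_square)
qed

end

section \<open>Averages of finitely many resolvents\<close>

definition avg :: "nat \<Rightarrow> (nat \<Rightarrow> 'a::real_vector) \<Rightarrow> 'a" where
  "avg M f = (\<Sum>i=1..M. f i) /\<^sub>R real M"

lemma avg_cong:
  assumes "\<And>i. i \<in> {1..M} \<Longrightarrow> f i = g i"
  shows "avg M f = avg M g"
proof -
  have "(\<Sum>i=1..M. f i) = (\<Sum>i=1..M. g i)"
    using assms by (rule sum.cong[OF refl])
  then show ?thesis by (simp only: avg_def)
qed

lemma avg_add: "avg M (\<lambda>i. f i + g i) = avg M f + avg M g"
  by (simp add: avg_def sum.distrib scaleR_add_right)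

lemma avg_diff: "avg M (\<lambda>i. f i - g i) = avg M f - avg M g"
  by (simp add: avg_def sum_subtractf scaleR_diff_right)

lemma linear_avg: "linear h \<Longrightarrow> h (avg M f) = avg M (\<lambda>i. h (f i))"
  by (simp add: avg_def linear_scale linear_sum)

lemma avg_scaleR: "avg M (\<lambda>i. c *\<^sub>R f i) = c *\<^sub>R avg M f"
  by (rule linear_avg[symmetric]) (rule linear_scaleR)

lemma avg_mult_left: "avg M (\<lambda>i. c * f i) = c * avg M f" for c :: real
  using avg_scaleR[of M c f] by simp

lemma avg_const: "M \<ge> 1 \<Longrightarrow> avg M (\<lambda>i. c) = c"
  by (simp add: avg_def sum_constant_scaleR)

lemma avg_mono:
  fixes f g :: "nat \<Rightarrow> real"
  assumes "\<And>i. i \<in> {1..M} \<Longrightarrow> f i \<le> g i"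
  shows "avg M f \<le> avg M g"
  unfolding avg_def real_scaleR_def by (intro mult_left_mono sum_mono assms) auto

lemma avg_eq_0_iff:
  fixes f :: "nat \<Rightarrow> real"
  assumes "\<And>i. i \<in> {1..M} \<Longrightarrow> 0 \<le> f i" and "M \<ge> 1"
  shows "avg M f = 0 \<longleftrightarrow> (\<forall>i\<in>{1..M}. f i = 0)"
  using assms sum_nonneg_eq_0_iff[of "{1..M}" f] by (auto simp: avg_def)

lemma norm_avg_le: "norm (avg M f) \<le> avg M (\<lambda>i. norm (f i))"
  by (simp add: avg_def mult_left_mono norm_sum)

lemma avg_matrix_vector_mult: "avg M C *v v = avg M (\<lambda>i. C i *v v)"
  for C :: "nat \<Rightarrow> real^'n^'m"
  by (rule linear_avg) (rule linearI,
      simp_all only: matrix_vector_mult_add_rdistrib scaleR_matrix_vector_assoc)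

lemma inner_avg: "v \<bullet> avg M f = avg M (\<lambda>i. v \<bullet> f i)"
  by (rule linear_avg) (auto intro!: linearI simp: inner_add_right)

lemma transpose_avg: "transpose (avg M C) = avg M (\<lambda>i. transpose (C i))"
  for C :: "nat \<Rightarrow> real^'n^'m"
  by (rule linear_avg) (auto intro!: linearI simp: transpose_def vec_eq_iff)

context
  fixes \<alpha> L :: real and K :: "nat \<Rightarrow> real^'n^'l" and M :: nat
    and R B :: "real^'n^'n"
  assumes alpha: "\<alpha> > 0" and M: "M \<ge> 1"
    and kernel: "\<And>v. (\<And>i. i \<in> {1..M} \<Longrightarrow> K i *v v = 0) \<Longrightarrow> v = 0"
    and L: "\<And>i u. i \<in> {1..M} \<Longrightarrow> (norm (K i *v u))\<^sup>2 \<le> L * (norm u)\<^sup>2"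
  defines "R \<equiv> avg M (\<lambda>i. resolvent \<alpha> (K i))" and "B \<equiv> mat 1 - R"
begin

lemma mean_complement_apply: "B *v v = v - R *v v"
  by (simp add: B_def matrix_vector_mult_diff_rdistrib)

lemma inner_mean_complement: "v \<bullet> (B *v v) = avg M (\<lambda>i. v \<bullet> (v - resolvent \<alpha> (K i) *v v))"
proof -
  have "B *v v = avg M (\<lambda>i. v - resolvent \<alpha> (K i) *v v)"
    using M by (simp add: mean_complement_apply R_def avg_matrix_vector_mult avg_diff avg_const)
  then show ?thesis by (simp only: inner_avg)
qed

lemma mean_complement_symmetric: "transpose B = B"
proof -
  have "transpose R = R"
    unfolding R_def transpose_avg by (simp only: resolvent_symmetric[OF alpha])
  then show ?thesis
    by (simp add: B_def transpose_def vec_eq_iff mat_def)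
qed

text \<open>If the form vanishes at \<open>v\<close>, every one of its nonnegative summands does, and \<open>v\<close> lies in the
  common kernel of the \<open>K i\<close>.\<close>

lemma mean_complement_pos:
  assumes "v \<noteq> 0"
  shows "0 < v \<bullet> (B *v v)"
proof -
  have "\<not> (\<forall>i\<in>{1..M}. v \<bullet> (v - resolvent \<alpha> (K i) *v v) = 0)"
    using inner_minus_resolvent_eq_0[OF alpha] kernel assms by metis
  then have "v \<bullet> (B *v v) \<noteq> 0"
    unfolding inner_mean_complement
    by (subst avg_eq_0_iff) (use inner_minus_resolvent_nonneg[OF alpha] M in auto)
  moreover have "avg M (\<lambda>i. 0 :: real) \<le> v \<bullet> (B *v v)"
    unfolding inner_mean_complement by (rule avg_mono) (rule inner_minus_resolvent_nonneg[OF alpha])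
  ultimately show ?thesis using M by (simp add: avg_const)
qed

lemma lambda_min_mean_complement_pos: "0 < lambda_min B"
proof -
  obtain v where v: "v \<noteq> 0" "B *v v = lambda_min B *\<^sub>R v"
    using lambda_min_rayleigh(1)[OF mean_complement_symmetric] by (auto simp: eigenvalues_def)
  then have "0 < lambda_min B * (v \<bullet> v)"
    using mean_complement_pos[of v] by simp
  with v(1) show ?thesis using zero_less_mult_pos2 inner_gt_zero_iff by blast
qed

lemma bound_nonneg: "0 \<le> L"
  using order_trans[OF zero_le_power2 L[of 1 "axis undefined 1"]] M by simp

text \<open>For each single resolvent with image \<open>u\<close> of \<open>v\<close>, the Cauchy-Schwarz inequality and
  \<open>norm_minus_resolvent_le\<close> bound \<open>v \<bullet> (v - u)\<close> by \<open>\<alpha> L / (1 + \<alpha> L)\<close> times \<open>|v|\<^sup>2\<close>.\<close>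

lemma mean_complement_le: "(1 + \<alpha> * L) * (v \<bullet> (B *v v)) \<le> \<alpha> * L * (norm v)\<^sup>2"
proof -
  have "(1 + \<alpha> * L) * (v \<bullet> (v - resolvent \<alpha> (K i) *v v)) \<le> \<alpha> * L * (norm v)\<^sup>2"
    if i: "i \<in> {1..M}" for i
  proof -
    define g where "g = v - resolvent \<alpha> (K i) *v v"
    have aL: "0 \<le> \<alpha> * L" using alpha bound_nonneg by simp
    have "(v \<bullet> g)\<^sup>2 \<le> (norm v)\<^sup>2 * (norm g)\<^sup>2"
      by (metis Cauchy_Schwarz_ineq power2_norm_eq_inner)
    then have "(1 + \<alpha> * L) * (v \<bullet> g)\<^sup>2 \<le> (1 + \<alpha> * L) * ((norm v)\<^sup>2 * (norm g)\<^sup>2)"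
      using aL by (intro mult_left_mono) auto
    also have "\<dots> = (norm v)\<^sup>2 * ((1 + \<alpha> * L) * (norm g)\<^sup>2)" by simp
    also have "\<dots> \<le> (norm v)\<^sup>2 * (\<alpha> * L * (v \<bullet> g))"
      unfolding g_def by (intro mult_left_mono norm_minus_resolvent_le[OF alpha] L[OF i]) auto
    finally have "(1 + \<alpha> * L) * (v \<bullet> g) * (v \<bullet> g) \<le> \<alpha> * L * (norm v)\<^sup>2 * (v \<bullet> g)"
      by (simp add: power2_eq_square mult_ac)
    moreover have "0 \<le> v \<bullet> g"
      unfolding g_def by (rule inner_minus_resolvent_nonneg[OF alpha])
    ultimately show ?thesis
      unfolding g_def[symmetric] using aL
      by (cases "v \<bullet> g = 0") (auto simp: mult_le_cancel_right)
  qed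
  then have "avg M (\<lambda>i. (1 + \<alpha> * L) * (v \<bullet> (v - resolvent \<alpha> (K i) *v v)))
      \<le> avg M (\<lambda>i. \<alpha> * L * (norm v)\<^sup>2)"
    by (rule avg_mono)
  then show ?thesis
    using M by (simp only: inner_mean_complement avg_mult_left avg_const)
qed

text \<open>With \<open>t = \<alpha> L\<close>, the preceding lemma gives \<open>lambda_min B \<le> t / (1 + t)\<close>. Hence \<open>2 c \<le> 2 t / (1 + t)\<^sup>2\<close>,
  which is below \<open>1\<close>.\<close>

lemma rate_bounds:
  defines "c \<equiv> lambda_min B / (1 + \<alpha> * L)"
  shows "0 < c" and "2 * c < 1"
proof -
  have aL: "0 \<le> \<alpha> * L" using alpha bound_nonneg by simp
  then show "0 < c"
    unfolding c_def using lambda_min_mean_complement_pos by simp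
  let ?v = "axis undefined 1 :: real^'n"
  have "(1 + \<alpha> * L) * lambda_min B \<le> (1 + \<alpha> * L) * (?v \<bullet> (B *v ?v))"
    using lambda_min_rayleigh(2)[OF mean_complement_symmetric, of ?v] aL
    by (intro mult_left_mono) auto
  also have "\<dots> \<le> \<alpha> * L"
    using mean_complement_le[of ?v] by simp
  finally have "(1 + \<alpha> * L) * lambda_min B \<le> \<alpha> * L" .
  moreover have "2 * (\<alpha> * L) < (1 + \<alpha> * L) * (1 + \<alpha> * L)"
  proof -
    have "(1 + \<alpha> * L) * (1 + \<alpha> * L) = 1 + 2 * (\<alpha> * L) + (\<alpha> * L)\<^sup>2"
      by (simp add: power2_eq_square algebra_simps)
    then show ?thesis using zero_le_power2[of "\<alpha> * L"] by linarith
  qed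
  ultimately have "(1 + \<alpha> * L) * (2 * lambda_min B) < (1 + \<alpha> * L) * (1 + \<alpha> * L)"
    by linarith
  then have "2 * lambda_min B < 1 + \<alpha> * L"
    using aL by (subst (asm) mult_less_cancel_left_pos) auto
  then show "2 * c < 1"
    unfolding c_def using aL by simp
qed

text \<open>The average inherits firm nonexpansiveness by convexity of the norm, so
  \<open>|R v|\<^sup>2 \<le> v \<bullet> R v = |v|\<^sup>2 - v \<bullet> B v\<close>.\<close>

lemma mean_resolvent_contraction: "(norm (R *v v))\<^sup>2 \<le> (1 - lambda_min B) * (norm v)\<^sup>2"
proof -
  have "2 *\<^sub>R (R *v v) - v = avg M (\<lambda>i. 2 *\<^sub>R (resolvent \<alpha> (K i) *v v) - v)"
    using M by (simp add: R_def avg_matrix_vector_mult avg_diff avg_const avg_scaleR)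
  also have "norm \<dots> \<le> avg M (\<lambda>i. norm (2 *\<^sub>R (resolvent \<alpha> (K i) *v v) - v))"
    by (rule norm_avg_le)
  also have "\<dots> \<le> avg M (\<lambda>i. norm v)"
    by (rule avg_mono) (rule resolvent_firmly_nonexpansive[OF alpha])
  finally have "(norm (2 *\<^sub>R (R *v v) - v))\<^sup>2 \<le> (norm v)\<^sup>2"
    using M by (simp add: avg_const power_mono)
  moreover have "(norm (2 *\<^sub>R (R *v v) - v))\<^sup>2
      = 4 * (norm (R *v v))\<^sup>2 - 4 * (v \<bullet> (R *v v)) + (norm v)\<^sup>2"
    by (simp only: power2_norm_eq_inner) (simp add: algebra_simps inner_commute)
  moreover have "v \<bullet> (R *v v) = (norm v)\<^sup>2 - v \<bullet> (B *v v)"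
    by (simp add: mean_complement_apply inner_diff_right power2_norm_eq_inner)
  moreover have "lambda_min B * (norm v)\<^sup>2 \<le> v \<bullet> (B *v v)"
    by (rule lambda_min_rayleigh(2)[OF mean_complement_symmetric])
  ultimately show ?thesis by (simp add: algebra_simps)
qed

lemma spectral_norm_mean_resolvent_less_1: "spectral_norm R < 1"
proof -
  have nonneg: "0 \<le> 1 - lambda_min B"
    using order_trans[OF zero_le_power2 mean_resolvent_contraction[of "axis undefined 1"]] by simp
  have "norm (R *v v) \<le> sqrt (1 - lambda_min B) * norm v" for v
    using real_sqrt_le_mono[OF mean_resolvent_contraction[of v]] by (simp add: real_sqrt_mult)
  then have "spectral_norm R \<le> sqrt (1 - lambda_min B)"
    unfolding spectral_norm_def using nonneg by (intro onorm_bound) auto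
  also have "\<dots> < 1"
    using lambda_min_mean_complement_pos by simp
  finally show ?thesis .
qed

text \<open>Write \<open>G = I - R\<^sub>i\<close> and \<open>n\<^sub>i = R\<^sub>i r\<^sub>i\<close>, so that the vector inside the norm is
  \<open>e - (G e + \<alpha> n\<^sub>i)\<close>. Expanding the square, the cross term of \<open>e\<close> with the noise \<open>n\<^sub>i\<close> averages to zero.
  The square of \<open>G e + \<alpha> n\<^sub>i\<close> is split at the price of a factor \<open>2\<close>, and the part \<open>2 |G e|\<^sup>2\<close> is absorbed by
  the descent term \<open>- 2 e \<bullet> G e\<close>, leaving the fraction \<open>1 / (1 + \<alpha> L)\<close> of it.\<close>

lemma mean_square_step:
  fixes e :: "real^'n" and r :: "nat \<Rightarrow> real^'n"
  assumes unbiased: "avg M (\<lambda>i. resolvent \<alpha> (K i) *v r i) = 0"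
  shows "avg M (\<lambda>i. (norm (resolvent \<alpha> (K i) *v e - \<alpha> *\<^sub>R (resolvent \<alpha> (K i) *v r i)))\<^sup>2)
    \<le> (1 - 2 * (lambda_min B / (1 + \<alpha> * L))) * (norm e)\<^sup>2 + 2 * \<alpha>\<^sup>2 * avg M (\<lambda>i. (norm (r i))\<^sup>2)"
proof -
  have pos: "0 < 1 + \<alpha> * L"
    using alpha bound_nonneg by (simp add: add_pos_nonneg)
  define s where "s = \<alpha> * L / (1 + \<alpha> * L)"
  have s: "1 - s = 1 / (1 + \<alpha> * L)"
    using pos by (simp add: s_def field_simps)
  define G where "G i = e - resolvent \<alpha> (K i) *v e" for i
  define n where "n i = resolvent \<alpha> (K i) *v r i" for i
  have step: "(norm (resolvent \<alpha> (K i) *v e - \<alpha> *\<^sub>R n i))\<^sup>2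
      \<le> (norm e)\<^sup>2 - 2 * (1 - s) * (e \<bullet> G i) - 2 * \<alpha> * (e \<bullet> n i) + 2 * \<alpha>\<^sup>2 * (norm (r i))\<^sup>2"
    if i: "i \<in> {1..M}" for i
  proof -
    have "resolvent \<alpha> (K i) *v e - \<alpha> *\<^sub>R n i = e - (G i + \<alpha> *\<^sub>R n i)"
      by (simp add: G_def)
    then have "(norm (resolvent \<alpha> (K i) *v e - \<alpha> *\<^sub>R n i))\<^sup>2
        = (norm e)\<^sup>2 - 2 * (e \<bullet> G i) - 2 * \<alpha> * (e \<bullet> n i) + (norm (G i + \<alpha> *\<^sub>R n i))\<^sup>2"
      by (simp only: power2_norm_eq_inner) (simp add: algebra_simps inner_commute)
    \<comment> \<open>Parallelogram law.\<close>
    also have "(norm (G i + \<alpha> *\<^sub>R n i))\<^sup>2 \<le> 2 * (norm (G i))\<^sup>2 + 2 * (norm (\<alpha> *\<^sub>R n i))\<^sup>2"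
    proof -
      have "0 \<le> (norm (G i - \<alpha> *\<^sub>R n i))\<^sup>2" by simp
      also have "\<dots> = 2 * (norm (G i))\<^sup>2 + 2 * (norm (\<alpha> *\<^sub>R n i))\<^sup>2 - (norm (G i + \<alpha> *\<^sub>R n i))\<^sup>2"
        by (simp only: power2_norm_eq_inner) (simp add: algebra_simps inner_commute)
      finally show ?thesis by simp
    qed
    also have "(norm (G i))\<^sup>2 \<le> s * (e \<bullet> G i)"
      using norm_minus_resolvent_le[OF alpha L[OF i], of e] pos
      by (simp add: G_def s_def field_simps)
    also have "(norm (\<alpha> *\<^sub>R n i))\<^sup>2 \<le> \<alpha>\<^sup>2 * (norm (r i))\<^sup>2"
      unfolding norm_scaleR power_mult_distrib power2_abs n_def
      by (intro mult_left_mono power_mono resolvent_nonexpansive[OF alpha]) auto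
    finally show ?thesis by (simp add: algebra_simps)
  qed
  have "avg M (\<lambda>i. (norm (resolvent \<alpha> (K i) *v e - \<alpha> *\<^sub>R n i))\<^sup>2)
      \<le> avg M (\<lambda>i. (norm e)\<^sup>2 - 2 * (1 - s) * (e \<bullet> G i) - 2 * \<alpha> * (e \<bullet> n i) + 2 * \<alpha>\<^sup>2 * (norm (r i))\<^sup>2)"
    using step by (rule avg_mono)
  also have "\<dots> = (norm e)\<^sup>2 - 2 * (1 - s) * avg M (\<lambda>i. e \<bullet> G i) - 2 * \<alpha> * avg M (\<lambda>i. e \<bullet> n i)
      + 2 * \<alpha>\<^sup>2 * avg M (\<lambda>i. (norm (r i))\<^sup>2)"
    using M by (simp only: avg_add avg_diff avg_mult_left avg_const)
  also have "avg M (\<lambda>i. e \<bullet> n i) = 0"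
    using unbiased by (simp add: n_def flip: inner_avg)
  also have "avg M (\<lambda>i. e \<bullet> G i) = e \<bullet> (B *v e)"
    by (simp only: inner_mean_complement G_def)
  finally have 1: "avg M (\<lambda>i. (norm (resolvent \<alpha> (K i) *v e - \<alpha> *\<^sub>R n i))\<^sup>2)
      \<le> (norm e)\<^sup>2 - 2 * (1 - s) * (e \<bullet> (B *v e)) + 2 * \<alpha>\<^sup>2 * avg M (\<lambda>i. (norm (r i))\<^sup>2)"
    by simp
  have "(1 - s) * (lambda_min B * (norm e)\<^sup>2) \<le> (1 - s) * (e \<bullet> (B *v e))"
    using pos by (intro mult_left_mono lambda_min_rayleigh(2)[OF mean_complement_symmetric]) (simp add: s)
  then have 2: "(norm e)\<^sup>2 - 2 * (1 - s) * (e \<bullet> (B *v e))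
      \<le> (norm e)\<^sup>2 - 2 * ((1 - s) * (lambda_min B * (norm e)\<^sup>2))"
    by (simp only: mult.assoc)
  have 3: "(1 - 2 * (lambda_min B / (1 + \<alpha> * L))) * (norm e)\<^sup>2
      = (norm e)\<^sup>2 - 2 * ((1 - s) * (lambda_min B * (norm e)\<^sup>2))"
    by (simp add: s left_diff_distrib)
  show ?thesis
    unfolding n_def[symmetric] 3 by (rule order_trans[OF 1 add_right_mono[OF 2]])
qed

end

section \<open>Continuity of the damped inverse\<close>

lemma continuous_on_matrix_vector_mult [continuous_intros]:
  fixes f :: "'a::topological_space \<Rightarrow> real^'n^'m"
  assumes "continuous_on S f" "continuous_on S g"
  shows "continuous_on S (\<lambda>x. f x *v g x)"
  unfolding matrix_vector_mult_def by (intro continuous_intros assms)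

lemma continuous_on_matrix_matrix_mult [continuous_intros]:
  fixes f :: "'a::topological_space \<Rightarrow> real^'n^'m"
  assumes "continuous_on S f" "continuous_on S g"
  shows "continuous_on S (\<lambda>x. f x ** g x)"
  unfolding matrix_matrix_mult_def by (intro continuous_intros assms)

lemma continuous_on_transpose [continuous_intros]:
  fixes f :: "'a::topological_space \<Rightarrow> real^'n^'m"
  assumes "continuous_on S f"
  shows "continuous_on S (\<lambda>x. transpose (f x))"
  unfolding transpose_def by (intro continuous_intros assms)

text \<open>The resolvent identity \<open>R' - R = \<alpha> R' (K\<^sup>T K - K'\<^sup>T K') R\<close>, with \<open>R'\<close> nonexpansive. Since \<open>R w\<close> is
  fixed when \<open>K'\<close> varies, this makes the resolvent a continuous, hence measurable, function of the
  matrix.\<close>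

lemma norm_resolvent_diff_le:
  fixes K K' :: "real^'n^'l"
    and w :: "real^'n"
  assumes alpha: "\<alpha> > 0"
  defines "u \<equiv> resolvent \<alpha> K *v w"
  shows "norm (resolvent \<alpha> K' *v w - resolvent \<alpha> K *v w)
    \<le> \<alpha> * norm (transpose K *v (K *v u) - transpose K' *v (K' *v u))"
proof -
  have w: "w = u + \<alpha> *\<^sub>R (transpose K *v (K *v u))"
    unfolding u_def by (rule resolvent_decompose[OF alpha])
  have "resolvent \<alpha> K' *v w - u = resolvent \<alpha> K' *v
      (\<alpha> *\<^sub>R (transpose K *v (K *v u) - transpose K' *v (K' *v u)))"
    using resolvent_gram[OF alpha, of K' u]
    by (subst w) (simp add: matrix_vector_right_distrib matrix_vector_mult_scaleR
        matrix_vector_mult_diff_distrib scaleR_diff_right del: transpose_matrix_vector)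
  also have "norm \<dots> \<le> norm (\<alpha> *\<^sub>R (transpose K *v (K *v u) - transpose K' *v (K' *v u)))"
    by (rule resolvent_nonexpansive[OF alpha])
  finally show ?thesis
    using alpha by (simp add: u_def del: transpose_matrix_vector)
qed

lemma continuous_resolvent:
  fixes K :: "real^'n^'l"
  assumes alpha: "\<alpha> > 0"
  shows "isCont (resolvent \<alpha>) K"
proof -
  have "(\<lambda>K'. resolvent \<alpha> K' *v w) \<midarrow>K\<rightarrow> resolvent \<alpha> K *v w" for w :: "real^'n"
  proof -
    define h where "h K' = \<alpha> * norm (transpose K *v (K *v (resolvent \<alpha> K *v w))
      - transpose K' *v (K' *v (resolvent \<alpha> K *v w)))" for K' :: "real^'n^'l"
    have "continuous_on UNIV h"
      unfolding h_def by (intro continuous_intros)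
    then have "h \<midarrow>K\<rightarrow> h K"
      by (simp add: continuous_on_eq_continuous_at isCont_def)
    then have "h \<midarrow>K\<rightarrow> 0" by (simp add: h_def)
    then have "(\<lambda>K'. resolvent \<alpha> K' *v w - resolvent \<alpha> K *v w) \<midarrow>K\<rightarrow> 0"
      by (rule Lim_null_comparison[rotated])
        (intro always_eventually allI, unfold h_def, rule norm_resolvent_diff_le[OF alpha])
    then show ?thesis by (rule LIM_zero_cancel)
  qed
  then have "(\<lambda>K'. (resolvent \<alpha> K' *v axis j 1) $ i) \<midarrow>K\<rightarrow> (resolvent \<alpha> K *v axis j 1) $ i" for i j
    by (rule tendsto_vec_nth)
  then have "(\<lambda>K'. resolvent \<alpha> K' $ i $ j) \<midarrow>K\<rightarrow> resolvent \<alpha> K $ i $ j" for i j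
    by (simp add: matrix_vector_mult_basis column_def)
  then show ?thesis
    unfolding isCont_def by (intro vec_tendstoI)
qed

lemma continuous_on_resolvent [continuous_intros]:
  fixes f :: "'a::topological_space \<Rightarrow> real^'n^'l"
  assumes "\<alpha> > 0" "continuous_on S f"
  shows "continuous_on S (\<lambda>x. resolvent \<alpha> (f x))"
  by (rule continuous_on_compose2[OF continuous_at_imp_continuous_on[where s = UNIV] assms(2)])
    (use continuous_resolvent[OF assms(1)] in auto)

lemma continuous_on_sketch_mat [continuous_intros]:
  assumes "continuous_on S f"
  shows "continuous_on S (\<lambda>x. sketch_mat A (f x))"
  unfolding sketch_mat_def by (intro continuous_intros assms)

lemma continuous_on_sketch_vec [continuous_intros]:
  assumes "continuous_on S f"
  shows "continuous_on S (\<lambda>x. sketch_vec b (f x))"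
  unfolding sketch_vec_def by (intro continuous_intros assms)

lemma continuous_on_damped_inv [continuous_intros]:
  assumes "\<alpha> > 0" "continuous_on S f"
  shows "continuous_on S (\<lambda>x. damped_inv \<alpha> A (f x))"
  unfolding damped_inv_eq_resolvent by (intro continuous_intros assms)

section \<open>Sampling from a finite family\<close>

lemma integral_uniform_sample:
  fixes f :: "'a::topological_space \<Rightarrow> 'b::{banach, second_countable_topology}"
  assumes [measurable]: "f \<in> borel_measurable borel"
  shows "(\<integral>w. f w \<partial>distr (uniform_count_measure {1..M}) borel W) = avg M (\<lambda>i. f (W i))"
    and "integrable (distr (uniform_count_measure {1..M}) borel W) f"
proof -
  have [measurable]: "W \<in> uniform_count_measure {1..M} \<rightarrow>\<^sub>M borel"
    by (simp add: measurable_def space_uniform_count_measure sets_uniform_count_measure)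
  have "(\<integral>w. f w \<partial>distr (uniform_count_measure {1..M}) borel W)
      = (\<integral>i. f (W i) \<partial>uniform_count_measure {1..M})"
    by (rule integral_distr) measurable
  also have "\<dots> = (\<Sum>i=1..M. (1 / real M) *\<^sub>R f (W i))"
    unfolding uniform_count_measure_def by (subst lebesgue_integral_point_measure_finite) auto
  finally show "(\<integral>w. f w \<partial>distr (uniform_count_measure {1..M}) borel W) = avg M (\<lambda>i. f (W i))"
    by (simp add: avg_def scaleR_sum_right inverse_eq_divide)
  show "integrable (distr (uniform_count_measure {1..M}) borel W) f"
    by (subst integrable_distr_eq)
      (simp_all add: uniform_count_measure_def integrable_point_measure_finite)
qed

text \<open>The iterates are almost surely bounded because the samples almost surely come from a finite set.\<close>

lemma AE_uniform_sample:
  fixes W :: "nat \<Rightarrow> 'a::t1_space"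
  shows "AE w in distr (uniform_count_measure {1..M}) borel W. w \<in> W ` {1..M}"
proof -
  have W: "W \<in> uniform_count_measure {1..M} \<rightarrow>\<^sub>M borel"
    by (simp add: measurable_def space_uniform_count_measure sets_uniform_count_measure)
  have "{w \<in> space borel. w \<in> W ` {1..M}} \<in> sets borel"
    by (simp add: borel_closed finite_imp_closed)
  then show ?thesis
    using W by (subst AE_distr_iff) (auto intro!: AE_I2 simp: space_uniform_count_measure)
qed

text \<open>Fubini's theorem for a pair of independent variables, the first of which takes finitely many
  values. Independence is stated as factorization of the joint law, since \<open>indep_var\<close>
  relates only variables with the same type of values, whereas here one is a matrix and the other
  a vector.\<close>

lemma (in prob_space) indep_uniform_sample:
  fixes g :: "'v::{t1_space, second_countable_topology} \<times> 'x::second_countable_topology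
      \<Rightarrow> 'b::{banach, second_countable_topology}"
  assumes rv [measurable]: "V \<in> borel_measurable M" "X \<in> borel_measurable M"
    and indep: "distr M borel V \<Otimes>\<^sub>M distr M borel X = distr M (borel \<Otimes>\<^sub>M borel) (\<lambda>\<omega>. (V \<omega>, X \<omega>))"
    and V: "distr M borel V = distr (uniform_count_measure {1..N}) borel W"
    and g: "g \<in> borel_measurable (borel \<Otimes>\<^sub>M borel)"
    and int: "\<And>i. i \<in> {1..N} \<Longrightarrow> integrable M (\<lambda>\<omega>. g (W i, X \<omega>))"
  shows "integrable M (\<lambda>\<omega>. g (V \<omega>, X \<omega>))"
    and "(\<integral>\<omega>. g (V \<omega>, X \<omega>) \<partial>M) = avg N (\<lambda>i. \<integral>\<omega>. g (W i, X \<omega>) \<partial>M)"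
proof -
  let ?D = "distr M borel V" and ?E = "distr M borel X"
  interpret D: prob_space ?D by (rule prob_space_distr) measurable
  interpret E: prob_space ?E by (rule prob_space_distr) measurable
  interpret DE: pair_prob_space ?D ?E ..
  note g [measurable]
  have gw [measurable]: "(\<lambda>x. g (w, x)) \<in> borel_measurable borel" for w
    by measurable
  have inner: "(\<lambda>w. \<integral>x. g (w, x) \<partial>?E) \<in> borel_measurable borel"
    "(\<lambda>w. \<integral>x. norm (g (w, x)) \<partial>?E) \<in> borel_measurable borel"
    by (intro E.borel_measurable_lebesgue_integral; simp add: measurable_split_conv; fail)+
  have "AE w in ?D. integrable ?E (\<lambda>x. g (w, x))"
    unfolding V using AE_uniform_sample[of W N]
  proof eventually_elim
    case (elim w)
    then obtain i where "i \<in> {1..N}" "w = W i" by blast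
    then show ?case
      using int by (subst integrable_distr_eq) auto
  qed
  then have int_g: "integrable (?D \<Otimes>\<^sub>M ?E) g"
    using integral_uniform_sample(2)[OF inner(2), of N W] unfolding V[symmetric]
    by (intro DE.Fubini_integrable) simp_all
  then show "integrable M (\<lambda>\<omega>. g (V \<omega>, X \<omega>))"
    unfolding indep by (subst (asm) integrable_distr_eq) auto
  have "(\<integral>\<omega>. g (V \<omega>, X \<omega>) \<partial>M) = integral\<^sup>L (?D \<Otimes>\<^sub>M ?E) g"
    unfolding indep by (subst integral_distr) auto
  also have "\<dots> = (\<integral>w. (\<integral>x. g (w, x) \<partial>?E) \<partial>?D)"
    by (rule DE.integral_fst'[OF int_g, symmetric])
  also have "\<dots> = avg N (\<lambda>i. \<integral>x. g (W i, x) \<partial>?E)"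
    unfolding V by (rule integral_uniform_sample(1)[OF inner(1)])
  also have "\<dots> = avg N (\<lambda>i. \<integral>\<omega>. g (W i, X \<omega>) \<partial>M)"
    by (simp add: integral_distr)
  finally show "(\<integral>\<omega>. g (V \<omega>, X \<omega>) \<partial>M) = avg N (\<lambda>i. \<integral>\<omega>. g (W i, X \<omega>) \<partial>M)" .
qed

section \<open>One step of the iteration\<close>

definition residual :: "real^'n^'m \<Rightarrow> real^'m \<Rightarrow> real^'l^'m \<Rightarrow> real^'n \<Rightarrow> real^'n" where
  "residual A b V x = transpose (sketch_mat A V) *v (sketch_mat A V *v x - sketch_vec b V)"

definition update :: "real^'n^'m \<Rightarrow> real^'m \<Rightarrow> real \<Rightarrow> real^'l^'m \<Rightarrow> real^'n \<Rightarrow> real^'n" where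
  "update A b \<alpha> V x = x - damped_inv \<alpha> A V *v residual A b V x"

lemma iterate_Suc_update:
  "iterate A b \<alpha> x\<^sub>0 V (Suc k) = update A b \<alpha> (V (Suc k)) (iterate A b \<alpha> x\<^sub>0 V k)"
  by (simp add: update_def residual_def)

text \<open>Every fixed reference point \<open>z\<close> turns a step into a nonexpansive linear map of the error plus a noise
  term that depends on the sample only. The choice \<open>z = 0\<close> bounds the iterates, and the limit point
  as \<open>z\<close> gives the error recursion.\<close>

lemma update_error:
  fixes A :: "real^'n^'m"
  assumes alpha: "\<alpha> > 0"
  defines "R \<equiv> \<lambda>V. resolvent \<alpha> (sketch_mat A V)"
  shows "update A b \<alpha> V x - z = R V *v (x - z) - \<alpha> *\<^sub>R (R V *v residual A b V z)"
proof -
  let ?K = "sketch_mat A V"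
  have "residual A b V x = transpose ?K *v (?K *v (x - z)) + residual A b V z"
    by (simp add: residual_def matrix_vector_mult_diff_distrib del: transpose_matrix_vector)
  then have "damped_inv \<alpha> A V *v residual A b V x
      = \<alpha> *\<^sub>R (R V *v (transpose ?K *v (?K *v (x - z)))) + \<alpha> *\<^sub>R (R V *v residual A b V z)"
    by (simp add: damped_inv_eq_resolvent R_def matrix_vector_right_distrib scaleR_add_right
        flip: scaleR_matrix_vector_assoc del: transpose_matrix_vector)
  also have "\<alpha> *\<^sub>R (R V *v (transpose ?K *v (?K *v (x - z)))) = (x - z) - R V *v (x - z)"
    unfolding R_def by (rule resolvent_gram[OF alpha])
  finally show ?thesis
    by (simp add: update_def)
qed

lemma borel_measurable_update:
  assumes "\<alpha> > 0"
  shows "(\<lambda>p. update A b \<alpha> (fst p) (snd p)) \<in> borel_measurable (borel \<Otimes>\<^sub>M borel)"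
  unfolding borel_prod update_def residual_def
  by (intro borel_measurable_continuous_onI continuous_intros assms)

lemma norm_update_le:
  assumes alpha: "\<alpha> > 0"
  shows "norm (update A b \<alpha> V x) \<le> norm x + \<alpha> * norm (residual A b V 0)"
proof -
  let ?R = "resolvent \<alpha> (sketch_mat A V)"
  have "update A b \<alpha> V x = ?R *v x - \<alpha> *\<^sub>R (?R *v residual A b V 0)"
    using update_error[OF alpha, of A b V x 0] by simp
  also have "norm \<dots> \<le> norm (?R *v x) + norm (\<alpha> *\<^sub>R (?R *v residual A b V 0))"
    by (rule norm_triangle_ineq4)
  also have "\<dots> \<le> norm x + \<alpha> * norm (residual A b V 0)"
    using alpha by (simp add: add_mono mult_left_mono resolvent_nonexpansive)
  finally show ?thesis .
qed

text \<open>The \<open>k\<close>-th iterate depends only on the first \<open>k\<close> samples, which makes it independent of the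
  next one.\<close>

lemma iterate_cong:
  "(\<And>i. i \<in> {1..k} \<Longrightarrow> V i = V' i) \<Longrightarrow> iterate A b \<alpha> x\<^sub>0 V k = iterate A b \<alpha> x\<^sub>0 V' k"
  by (induction k) (simp_all add: iterate_Suc_update del: iterate.simps(2))

lemma borel_measurable_iterate:
  assumes "\<alpha> > 0" and "{1..k} \<subseteq> I"
  shows "(\<lambda>V. iterate A b \<alpha> x\<^sub>0 V k) \<in> borel_measurable (PiM I (\<lambda>_. borel))"
  using assms(2)
proof (induction k)
  case (Suc k)
  have "Suc k \<in> I" and "{1..k} \<subseteq> I"
    using Suc.prems by auto
  note pair = measurable_Pair[OF measurable_component_singleton[OF this(1)] Suc.IH[OF this(2)]]
  from measurable_compose[OF pair borel_measurable_update[OF assms(1)]]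
  show ?case by (simp only: iterate_Suc_update fst_conv snd_conv)
qed simp

text \<open>The matrices whose largest eigenvalues enter \<^const>\<open>A_max\<close> are the Gram matrices of the sketched
  systems, so \<^const>\<open>A_max\<close> is a common bound \<open>L\<close> in the sense of the resolvent estimates.\<close>

lemma gram_eq_sketch:
  "transpose A ** V ** transpose V ** A = transpose (sketch_mat A V) ** sketch_mat A V"
  by (simp add: sketch_mat_def matrix_transpose_mul matrix_mul_assoc)

lemma norm_sketch_le_A_max:
  assumes "i \<in> {1..M}"
  shows "(norm (sketch_mat A (W i) *v u))\<^sup>2 \<le> A_max A W M * (norm u)\<^sup>2"
proof -
  let ?K = "sketch_mat A (W i)"
  have "transpose (transpose ?K ** ?K) = transpose ?K ** ?K"
    by (simp add: matrix_transpose_mul)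
  from lambda_max_rayleigh[OF this, of u]
  have "(norm (?K *v u))\<^sup>2 \<le> lambda_max (transpose ?K ** ?K) * (norm u)\<^sup>2"
    by (simp add: inner_matrix_transpose power2_norm_eq_inner
        flip: matrix_vector_mul_assoc del: transpose_matrix_vector)
  also have "\<dots> \<le> A_max A W M * (norm u)\<^sup>2"
    unfolding A_max_def gram_eq_sketch[symmetric] using assms
    by (intro mult_right_mono Max_ge) auto
  finally show ?thesis .
qed

section \<open>The random iteration\<close>

locale sketched_iteration = prob_space P
  for P :: "'w measure" +
  fixes A :: "real^'n^'m" and b :: "real^'m"
    and W :: "nat \<Rightarrow> real^'l^'m" and M :: nat
    and Wk :: "nat \<Rightarrow> 'w \<Rightarrow> real^'l^'m"
    and \<alpha> \<beta> :: real and x\<^sub>0 :: "real^'n" and j :: nat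
  assumes full_rank: "rank A = CARD('n)"
    and M: "M \<ge> 1"
    and indep: "indep_vars (\<lambda>_. borel) Wk {1..}"
    and law: "\<And>k. k \<ge> 1 \<Longrightarrow> distr P borel (Wk k) = distr (uniform_count_measure {1..M}) borel W"
    and beta: "\<beta> > 0"
    and isotropic: "\<And>k. k \<ge> 1 \<Longrightarrow> (\<integral>\<omega>. Wk k \<omega> ** transpose (Wk k \<omega>) \<partial>P) = \<beta> *\<^sub>R mat 1"
    and alpha: "\<alpha> > 0"
    and j: "j \<ge> 1"
begin

abbreviation "K i \<equiv> sketch_mat A (W i)"
abbreviation "R i \<equiv> resolvent \<alpha> (K i)"
abbreviation "x k \<omega> \<equiv> iterate A b \<alpha> x\<^sub>0 (\<lambda>i. Wk i \<omega>) k"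
abbreviation "xh \<equiv> x_hat P \<alpha> A b (Wk j)"
abbreviation "L \<equiv> A_max A W M"
definition "meanR = avg M R"
definition "B = mat 1 - meanR"

lemma random_variable_Wk: "k \<ge> 1 \<Longrightarrow> Wk k \<in> borel_measurable P"
  using indep unfolding indep_vars_def by auto

lemma expectation_sample:
  fixes f :: "real^'l^'m \<Rightarrow> 'b::{banach, second_countable_topology}"
  assumes "k \<ge> 1" and f: "continuous_on UNIV f"
  shows "(\<integral>\<omega>. f (Wk k \<omega>) \<partial>P) = avg M (\<lambda>i. f (W i))"
proof -
  have f': "f \<in> borel_measurable borel"
    by (rule borel_measurable_continuous_onI[OF f])
  have "(\<integral>\<omega>. f (Wk k \<omega>) \<partial>P) = (\<integral>w. f w \<partial>distr P borel (Wk k))"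
    by (rule integral_distr[symmetric]) (use random_variable_Wk assms(1) f' in auto)
  then show ?thesis
    by (simp only: law[OF assms(1)] integral_uniform_sample(1)[OF f'])
qed

text \<open>The average of the \<open>W i (W i)\<^sup>T\<close> is \<open>\<beta> I\<close>. Applied to \<open>A v\<close> it yields \<open>\<beta> A v\<close>, but also \<open>0\<close> if every
  \<open>(W i)\<^sup>T A v\<close> vanishes, so \<open>A v = 0\<close> and \<open>v = 0\<close> by full column rank.\<close>

lemma sketch_kernel_trivial:
  assumes "\<And>i. i \<in> {1..M} \<Longrightarrow> K i *v v = 0"
  shows "v = 0"
proof -
  have "\<beta> *\<^sub>R mat 1 = avg M (\<lambda>i. W i ** transpose (W i))"
    unfolding isotropic[OF j, symmetric]
    by (rule expectation_sample[OF j]) (intro continuous_intros)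
  then have "(\<beta> *\<^sub>R mat 1) *v (A *v v) = avg M (\<lambda>i. W i ** transpose (W i)) *v (A *v v)"
    by (simp only:)
  then have "\<beta> *\<^sub>R (A *v v) = avg M (\<lambda>i. W i *v (K i *v v))"
    by (simp add: avg_matrix_vector_mult sketch_mat_def
        flip: scaleR_matrix_vector_assoc matrix_vector_mul_assoc del: transpose_matrix_vector)
  also have "\<dots> = avg M (\<lambda>i. 0)"
    by (rule avg_cong) (simp add: assms)
  finally have "A *v v = 0"
    using beta M by (simp add: avg_const)
  then show ?thesis
    using full_rank unfolding full_rank_injective by (auto dest: injD[of _ v 0])
qed

lemma B_pos: "v \<noteq> 0 \<Longrightarrow> 0 < v \<bullet> (B *v v)"
  unfolding B_def meanR_def
  by (rule mean_complement_pos[OF alpha M sketch_kernel_trivial norm_sketch_le_A_max])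

lemma rate_pos: "0 < lambda_min B / (1 + \<alpha> * L)"
  unfolding B_def meanR_def
  by (rule rate_bounds(1)[OF alpha M sketch_kernel_trivial norm_sketch_le_A_max])

lemma rate_less_half: "2 * (lambda_min B / (1 + \<alpha> * L)) < 1"
  unfolding B_def meanR_def
  by (rule rate_bounds(2)[OF alpha M sketch_kernel_trivial norm_sketch_le_A_max])

lemma spectral_norm_meanR: "spectral_norm meanR < 1"
  unfolding meanR_def
  by (rule spectral_norm_mean_resolvent_less_1[OF alpha M sketch_kernel_trivial norm_sketch_le_A_max])

lemma damped_inv_gram:
  "damped_inv \<alpha> A V ** transpose (sketch_mat A V) ** sketch_mat A V
    = mat 1 - resolvent \<alpha> (sketch_mat A V)"
  using resolvent_gram[OF alpha, of "sketch_mat A V"]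
  by (subst matrix_eq)
    (simp add: damped_inv_eq_resolvent matrix_vector_mult_diff_rdistrib
      flip: scaleR_matrix_vector_assoc matrix_vector_mul_assoc del: transpose_matrix_vector)

lemma mean_damped_inv_eq: "mean_damped_inv P \<alpha> A (Wk j) /\<^sub>R \<alpha> = meanR"
proof -
  have "mean_damped_inv P \<alpha> A (Wk j) = avg M (\<lambda>i. damped_inv \<alpha> A (W i))"
    unfolding mean_damped_inv_def
    by (rule expectation_sample[OF j]) (intro continuous_intros alpha)
  then show ?thesis
    using alpha by (simp add: damped_inv_eq_resolvent avg_scaleR meanR_def)
qed

lemma mean_B_eq: "mean_B P \<alpha> A (Wk j) = B"
proof -
  have "mean_B P \<alpha> A (Wk j)
      = avg M (\<lambda>i. damped_inv \<alpha> A (W i) ** transpose (K i) ** K i)"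
    unfolding mean_B_def
    by (rule expectation_sample[OF j]) (intro continuous_intros alpha)
  then show ?thesis
    using M by (simp add: damped_inv_gram avg_diff avg_const B_def meanR_def)
qed

lemma sigma_sq_eq: "sigma_sq P \<alpha> A b (Wk j) = avg M (\<lambda>i. (norm (residual A b (W i) xh))\<^sup>2)"
  unfolding sigma_sq_def residual_def
  by (rule expectation_sample[OF j]) (intro continuous_intros)

text \<open>Multiplied by \<open>\<alpha>\<close>, this is the normal equation \<open>B xh = E (B\<^sub>k A\<^sub>k\<^sup>T b\<^sub>k)\<close> that defines the limit point: at
  \<open>xh\<close> the expected update direction is zero.\<close>

lemma residual_unbiased: "avg M (\<lambda>i. R i *v residual A b (W i) xh) = 0"
proof -
  let ?f = "\<lambda>V. damped_inv \<alpha> A V *v (transpose (sketch_mat A V) *v sketch_vec b V)"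
  have "xh = matrix_inv B *v avg M (\<lambda>i. ?f (W i))"
    unfolding x_hat_def mean_B_eq
    by (subst expectation_sample[OF j]) (intro continuous_intros alpha, rule refl)
  moreover have "B ** matrix_inv B = mat 1"
    using B_pos by (intro matrix_inv_of_trivial_kernel) force
  ultimately have normal_eq: "B *v xh = avg M (\<lambda>i. ?f (W i))"
    by (simp add: matrix_vector_mul_assoc)
  have "\<alpha> *\<^sub>R (R i *v residual A b (W i) xh) = (xh - R i *v xh) - ?f (W i)" for i
    unfolding residual_def
    by (simp add: damped_inv_eq_resolvent matrix_vector_mult_diff_distrib scaleR_diff_right
        resolvent_gram[OF alpha] flip: scaleR_matrix_vector_assoc del: transpose_matrix_vector)
  then have "\<alpha> *\<^sub>R avg M (\<lambda>i. R i *v residual A b (W i) xh)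
      = (xh - meanR *v xh) - avg M (\<lambda>i. ?f (W i))"
    using M by (simp only: avg_scaleR[symmetric] avg_diff avg_const meanR_def avg_matrix_vector_mult)
  also have "\<dots> = 0"
    by (simp add: B_def matrix_vector_mult_diff_rdistrib flip: normal_eq
        del: transpose_matrix_vector)
  finally show ?thesis using alpha by simp
qed

lemma random_variable_x: "x k \<in> borel_measurable P"
proof -
  have "(\<lambda>\<omega>. \<lambda>i\<in>{1..k}. Wk i \<omega>) \<in> P \<rightarrow>\<^sub>M PiM {1..k} (\<lambda>_. borel)"
    by (intro measurable_restrict random_variable_Wk) simp
  from measurable_compose[OF this borel_measurable_iterate[OF alpha order_refl]]
  have "(\<lambda>\<omega>. iterate A b \<alpha> x\<^sub>0 (\<lambda>i\<in>{1..k}. Wk i \<omega>) k) \<in> borel_measurable P" .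
  also have "(\<lambda>\<omega>. iterate A b \<alpha> x\<^sub>0 (\<lambda>i\<in>{1..k}. Wk i \<omega>) k) = x k"
    by (intro ext iterate_cong) simp
  finally show ?thesis .
qed

text \<open>The next sample and the current iterate are functions of disjoint blocks of an independent
  family.\<close>

lemma joint_law:
  "distr P borel (Wk (Suc k)) \<Otimes>\<^sub>M distr P borel (x k)
    = distr P (borel \<Otimes>\<^sub>M borel) (\<lambda>\<omega>. (Wk (Suc k) \<omega>, x k \<omega>))"
proof -
  let ?N = "PiM {Suc k} (\<lambda>_. borel) :: (nat \<Rightarrow> real^'l^'m) measure"
  let ?H = "PiM {1..k} (\<lambda>_. borel) :: (nat \<Rightarrow> real^'l^'m) measure"
  let ?n = "\<lambda>\<omega>. \<lambda>i\<in>{Suc k}. Wk i \<omega>" and ?h = "\<lambda>\<omega>. \<lambda>i\<in>{1..k}. Wk i \<omega>"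
  let ?f = "\<lambda>V. V (Suc k)" and ?g = "\<lambda>V. iterate A b \<alpha> x\<^sub>0 V k"
  have "indep_var ?N ?n ?H ?h"
    by (rule indep_var_restrict[OF indep]) auto
  then have n: "?n \<in> P \<rightarrow>\<^sub>M ?N" and h: "?h \<in> P \<rightarrow>\<^sub>M ?H"
    and prod: "distr P ?N ?n \<Otimes>\<^sub>M distr P ?H ?h = distr P (?N \<Otimes>\<^sub>M ?H) (\<lambda>\<omega>. (?n \<omega>, ?h \<omega>))"
    unfolding indep_var_distribution_eq by auto
  have f: "?f \<in> ?N \<rightarrow>\<^sub>M borel"
    by (rule measurable_component_singleton) simp
  have g: "?g \<in> ?H \<rightarrow>\<^sub>M borel"
    by (rule borel_measurable_iterate[OF alpha order_refl])
  have gh: "?g (?h \<omega>) = x k \<omega>" for \<omega>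
    by (rule iterate_cong) simp
  have 1: "distr (distr P ?N ?n) borel ?f = distr P borel (Wk (Suc k))"
    using n f by (subst distr_distr) (auto simp: comp_def)
  have 2: "distr (distr P ?H ?h) borel ?g = distr P borel (x k)"
    using h g by (subst distr_distr) (simp_all only: comp_def gh)
  interpret X: prob_space "distr P borel (x k)"
    by (rule prob_space_distr) (rule random_variable_x)
  have "distr P borel (Wk (Suc k)) \<Otimes>\<^sub>M distr P borel (x k)
      = distr (distr P ?N ?n \<Otimes>\<^sub>M distr P ?H ?h) (borel \<Otimes>\<^sub>M borel) (\<lambda>(u, v). (?f u, ?g v))"
    unfolding 1[symmetric] 2[symmetric]
    by (rule pair_measure_distr) (use f g in simp, use f g in simp, unfold 2, unfold_locales)
  also have "\<dots> = distr P (borel \<Otimes>\<^sub>M borel) ((\<lambda>(u, v). (?f u, ?g v)) \<circ> (\<lambda>\<omega>. (?n \<omega>, ?h \<omega>)))"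
    unfolding prod
    by (rule distr_distr) (intro measurable_split_conv[THEN iffD2] measurable_Pair
        measurable_compose[OF measurable_fst f] measurable_compose[OF measurable_snd g] n h)+
  also have "(\<lambda>(u, v). (?f u, ?g v)) \<circ> (\<lambda>\<omega>. (?n \<omega>, ?h \<omega>)) = (\<lambda>\<omega>. (Wk (Suc k) \<omega>, x k \<omega>))"
    by (simp add: fun_eq_iff gh del: One_nat_def)
  finally show ?thesis .
qed

text \<open>A step lengthens the iterate by at most \<open>\<alpha>\<close> times the residual at \<open>0\<close>, which is bounded over
  the finitely many sampled matrices. Hence all moments of the iterates exist.\<close>

lemma iterate_AE_bounded: "\<exists>C. AE \<omega> in P. norm (x k \<omega>) \<le> C"
proof (induction k)
  case 0
  then show ?case by auto
next
  case (Suc k)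
  then obtain C where C: "AE \<omega> in P. norm (x k \<omega>) \<le> C" by blast
  define Q where "Q = (\<Sum>i=1..M. norm (residual A b (W i) 0))"
  have Q: "norm (residual A b (W i) 0) \<le> Q" if "i \<in> {1..M}" for i
    unfolding Q_def by (rule member_le_sum[OF that]) auto
  have "AE w in distr P borel (Wk (Suc k)). w \<in> W ` {1..M}"
    by (subst law) (simp, rule AE_uniform_sample)
  then have "AE \<omega> in P. Wk (Suc k) \<omega> \<in> W ` {1..M}"
    by (rule AE_distrD[rotated]) (simp add: random_variable_Wk)
  with C have "AE \<omega> in P. norm (x (Suc k) \<omega>) \<le> C + \<alpha> * Q"
  proof eventually_elim
    case (elim \<omega>)
    then have "\<alpha> * norm (residual A b (Wk (Suc k) \<omega>) 0) \<le> \<alpha> * Q"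
      using Q alpha by (intro mult_left_mono) auto
    with norm_update_le[OF alpha, of A b "Wk (Suc k) \<omega>" "x k \<omega>"] elim(1) show ?case
      unfolding iterate_Suc_update by linarith
  qed
  then show ?case by blast
qed

lemma integrable_continuous_x:
  fixes h :: "real^'n \<Rightarrow> 'b::{banach, second_countable_topology}"
  assumes "continuous_on UNIV h"
  shows "integrable P (\<lambda>\<omega>. h (x k \<omega>))"
proof -
  obtain C where C: "AE \<omega> in P. norm (x k \<omega>) \<le> C"
    using iterate_AE_bounded by blast
  have "bounded (h ` cball 0 C)"
    by (intro compact_imp_bounded compact_continuous_image continuous_on_subset[OF assms]) auto
  then obtain D where D: "\<And>y. y \<in> cball 0 C \<Longrightarrow> norm (h y) \<le> D"
    unfolding bounded_iff by blast
  from C have "AE \<omega> in P. norm (h (x k \<omega>)) \<le> D"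
    by eventually_elim (simp add: D)
  moreover have "(\<lambda>\<omega>. h (x k \<omega>)) \<in> borel_measurable P"
    by (rule measurable_compose[OF random_variable_x borel_measurable_continuous_onI[OF assms]])
  ultimately show ?thesis
    by (rule integrable_const_bound)
qed

lemma expectation_update:
  fixes h :: "real^'n \<Rightarrow> 'b::{banach, second_countable_topology}"
  assumes h: "continuous_on UNIV h"
  shows "(\<integral>\<omega>. h (x (Suc k) \<omega>) \<partial>P) = avg M (\<lambda>i. \<integral>\<omega>. h (update A b \<alpha> (W i) (x k \<omega>)) \<partial>P)"
proof -
  let ?g = "\<lambda>p. h (update A b \<alpha> (fst p) (snd p))"
  have "?g \<in> borel_measurable (borel \<Otimes>\<^sub>M borel)"
    by (rule measurable_compose[OF borel_measurable_update[OF alpha] borel_measurable_continuous_onI[OF h]])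
  moreover have "integrable P (\<lambda>\<omega>. ?g (W i, x k \<omega>))" for i
    unfolding fst_conv snd_conv update_def residual_def
    by (rule integrable_continuous_x, rule continuous_on_compose2[OF h])
      (auto intro!: continuous_intros simp del: transpose_matrix_vector)
  ultimately have "(\<integral>\<omega>. ?g (Wk (Suc k) \<omega>, x k \<omega>) \<partial>P) = avg M (\<lambda>i. \<integral>\<omega>. ?g (W i, x k \<omega>) \<partial>P)"
    by (intro indep_uniform_sample(2)[OF random_variable_Wk random_variable_x joint_law law]) auto
  then show ?thesis
    by (simp only: iterate_Suc_update fst_conv snd_conv)
qed

text \<open>Conditioning on the current iterate, the expected step is affine with linear part the mean
  resolvent, and by \<open>residual_unbiased\<close> its fixed point is \<open>xh\<close>.\<close>

lemma mean_error_step: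
  "(\<integral>\<omega>. x (Suc k) \<omega> \<partial>P) - xh = meanR *v ((\<integral>\<omega>. x k \<omega> \<partial>P) - xh)"
proof -
  let ?m = "\<integral>\<omega>. x k \<omega> \<partial>P"
  let ?n = "\<lambda>i. \<alpha> *\<^sub>R (R i *v residual A b (W i) xh)"
  have "(\<integral>\<omega>. update A b \<alpha> (W i) (x k \<omega>) \<partial>P) = xh + R i *v (?m - xh) - ?n i" for i
  proof -
    have "update A b \<alpha> (W i) y = R i *v y + (xh - R i *v xh - ?n i)" for y
      using update_error[OF alpha, of A b "W i" y xh]
      by (simp add: matrix_vector_mult_diff_distrib algebra_simps)
    then have "(\<integral>\<omega>. update A b \<alpha> (W i) (x k \<omega>) \<partial>P)
        = (\<integral>\<omega>. R i *v x k \<omega> \<partial>P) + (xh - R i *v xh - ?n i)"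
      using integrable_continuous_x[of "\<lambda>y. R i *v y" k]
      by (simp add: prob_space matrix_vector_mult_linear_continuous_on)
    also have "(\<integral>\<omega>. R i *v x k \<omega> \<partial>P) = R i *v ?m"
      by (rule integral_bounded_linear[OF matrix_vector_mul_bounded_linear])
        (rule integrable_continuous_x, rule continuous_on_id)
    finally show ?thesis
      by (simp add: matrix_vector_mult_diff_distrib)
  qed
  then have "(\<integral>\<omega>. x (Suc k) \<omega> \<partial>P) = avg M (\<lambda>i. xh + R i *v (?m - xh) - ?n i)"
    using expectation_update[OF continuous_on_id, of k] by simp
  also have "\<dots> = xh + meanR *v (?m - xh)"
    using M by (simp only: avg_diff avg_add avg_const avg_scaleR residual_unbiased
        meanR_def avg_matrix_vector_mult scaleR_zero_right diff_zero)
  finally show ?thesis by simp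
qed

lemma mean_error_bound:
  "norm ((\<integral>\<omega>. x k \<omega> \<partial>P) - xh) \<le> spectral_norm meanR ^ k * norm (x\<^sub>0 - xh)"
proof (induction k)
  case 0
  then show ?case by (simp add: prob_space)
next
  case (Suc k)
  have bl: "bounded_linear (\<lambda>v. meanR *v v)" by simp
  have "norm ((\<integral>\<omega>. x (Suc k) \<omega> \<partial>P) - xh)
      \<le> spectral_norm meanR * norm ((\<integral>\<omega>. x k \<omega> \<partial>P) - xh)"
    unfolding mean_error_step spectral_norm_def by (rule onorm[OF bl])
  also have "\<dots> \<le> spectral_norm meanR * (spectral_norm meanR ^ k * norm (x\<^sub>0 - xh))"
    by (intro mult_left_mono Suc.IH) (simp add: spectral_norm_def onorm_pos_le[OF bl])
  finally show ?case by (simp only: power_Suc mult.assoc)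
qed

lemma mean_square_error_step:
  defines "c \<equiv> lambda_min B / (1 + \<alpha> * L)"
  shows "(\<integral>\<omega>. (norm (x (Suc k) \<omega> - xh))\<^sup>2 \<partial>P)
    \<le> (1 - 2 * c) * (\<integral>\<omega>. (norm (x k \<omega> - xh))\<^sup>2 \<partial>P) + 2 * \<alpha>\<^sup>2 * sigma_sq P \<alpha> A b (Wk j)"
proof -
  let ?s2 = "sigma_sq P \<alpha> A b (Wk j)"
  define q where "q i y = (norm (R i *v (y - xh) - \<alpha> *\<^sub>R (R i *v residual A b (W i) xh)))\<^sup>2" for i y
  have int_q: "integrable P (\<lambda>\<omega>. q i (x k \<omega>))" for i
    unfolding q_def by (rule integrable_continuous_x) (intro continuous_intros)
  have int_sq: "integrable P (\<lambda>\<omega>. (norm (x k \<omega> - xh))\<^sup>2)"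
    by (rule integrable_continuous_x) (intro continuous_intros)
  have "(\<integral>\<omega>. (norm (x (Suc k) \<omega> - xh))\<^sup>2 \<partial>P) = avg M (\<lambda>i. \<integral>\<omega>. q i (x k \<omega>) \<partial>P)"
    unfolding q_def update_error[OF alpha, symmetric]
    by (rule expectation_update) (intro continuous_intros)
  also have "\<dots> = (\<integral>\<omega>. avg M (\<lambda>i. q i (x k \<omega>)) \<partial>P)"
    unfolding avg_def using int_q by simp
  also have "\<dots> \<le> (\<integral>\<omega>. (1 - 2 * c) * (norm (x k \<omega> - xh))\<^sup>2 + 2 * \<alpha>\<^sup>2 * ?s2 \<partial>P)"
  proof (rule integral_mono)
    show "integrable P (\<lambda>\<omega>. avg M (\<lambda>i. q i (x k \<omega>)))"
      unfolding avg_def using int_q by simp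
    show "integrable P (\<lambda>\<omega>. (1 - 2 * c) * (norm (x k \<omega> - xh))\<^sup>2 + 2 * \<alpha>\<^sup>2 * ?s2)"
      using int_sq by simp
    show "avg M (\<lambda>i. q i (x k \<omega>)) \<le> (1 - 2 * c) * (norm (x k \<omega> - xh))\<^sup>2 + 2 * \<alpha>\<^sup>2 * ?s2" for \<omega>
      unfolding q_def sigma_sq_eq c_def B_def meanR_def
      by (rule mean_square_step[OF alpha M sketch_kernel_trivial norm_sketch_le_A_max residual_unbiased])
  qed
  also have "\<dots> = (1 - 2 * c) * (\<integral>\<omega>. (norm (x k \<omega> - xh))\<^sup>2 \<partial>P) + 2 * \<alpha>\<^sup>2 * ?s2"
    using int_sq by (simp add: prob_space)
  finally show ?thesis .
qed

lemma mean_square_error_bound: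
  defines "c \<equiv> lambda_min B / (1 + \<alpha> * L)"
  shows "(\<integral>\<omega>. (norm (x k \<omega> - xh))\<^sup>2 \<partial>P)
    \<le> (1 - 2 * c) ^ k * (norm (x\<^sub>0 - xh))\<^sup>2 + \<alpha>\<^sup>2 * inverse c * sigma_sq P \<alpha> A b (Wk j)"
proof (induction k)
  have c: "0 < c" "2 * c < 1"
    unfolding c_def by (rule rate_pos, rule rate_less_half)
  let ?s2 = "sigma_sq P \<alpha> A b (Wk j)"
  let ?E = "\<lambda>k. \<integral>\<omega>. (norm (x k \<omega> - xh))\<^sup>2 \<partial>P"
  define H where "H = \<alpha>\<^sup>2 * inverse c * ?s2"
  {
    case 0
    have "0 \<le> ?s2" by (simp add: sigma_sq_def)
    then show ?case using c by (simp add: prob_space)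
  next
    case (Suc k)
    \<comment> \<open>The asymptotic error level \<open>H\<close> is the fixed point of the recursion \<open>h \<mapsto> (1 - 2 c) h + 2 \<alpha>\<^sup>2 \<sigma>\<^sup>2\<close>.\<close>
    have fixpoint: "(1 - 2 * c) * H + 2 * \<alpha>\<^sup>2 * ?s2 = H"
      using c by (simp add: H_def field_simps)
    have "?E (Suc k) \<le> (1 - 2 * c) * ?E k + 2 * \<alpha>\<^sup>2 * ?s2"
      unfolding c_def by (rule mean_square_error_step)
    also have "\<dots> \<le> (1 - 2 * c) * ((1 - 2 * c) ^ k * (norm (x\<^sub>0 - xh))\<^sup>2 + H) + 2 * \<alpha>\<^sup>2 * ?s2"
      using Suc c unfolding H_def by (intro add_right_mono mult_left_mono) auto
    also have "\<dots> = (1 - 2 * c) ^ Suc k * (norm (x\<^sub>0 - xh))\<^sup>2 + H"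
      by (simp only: distrib_left add.assoc power_Suc mult.assoc fixpoint[unfolded mult.assoc])
    finally show ?case unfolding H_def .
  }
qed

end

section \<open>Convergence in mean and mean square error\<close>

theorem theorem3p1:
  fixes A :: "real^'n^'m" and b :: "real^'m"
    and W :: "nat \<Rightarrow> real^'l^'m" and M :: nat
    and P :: "'w measure" and Wk :: "nat \<Rightarrow> 'w \<Rightarrow> real^'l^'m"
    and \<alpha> \<beta> :: real and x\<^sub>0 :: "real^'n" and j :: nat
  assumes "rank A = CARD('n)"
    and "M \<ge> 1"
    and "prob_space P"
    and "prob_space.indep_vars P (\<lambda>_. borel) Wk {1..}"
    and "\<And>k. k \<ge> 1 \<Longrightarrow> distr P borel (Wk k) = distr (uniform_count_measure {1..M}) borel W"
    and "\<beta> > 0"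
    and "\<And>k. k \<ge> 1 \<Longrightarrow> (\<integral>\<omega>. Wk k \<omega> ** transpose (Wk k \<omega>) \<partial>P) = \<beta> *\<^sub>R mat 1"
    and "\<alpha> > 0"
    and "j \<ge> 1"
  shows
    "let x = (\<lambda>k \<omega>. iterate A b \<alpha> x\<^sub>0 (\<lambda>i. Wk i \<omega>) k);
         B = mean_B P \<alpha> A (Wk j);
         xh = x_hat P \<alpha> A b (Wk j);
         \<rho> = spectral_norm (mean_damped_inv P \<alpha> A (Wk j) /\<^sub>R \<alpha>);
         c = lambda_min B / (1 + \<alpha> * A_max A W M);
         s2 = sigma_sq P \<alpha> A b (Wk j)
     in (\<forall>k. integrable P (x k))
        \<and> (\<lambda>k. \<integral>\<omega>. x k \<omega> \<partial>P) \<longlonglongrightarrow> xh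
        \<and> (\<forall>k. norm ((\<integral>\<omega>. x k \<omega> \<partial>P) - xh) \<le> \<rho> ^ k * norm (x\<^sub>0 - xh))
        \<and> \<rho> < 1
        \<and> (\<forall>k. integrable P (\<lambda>\<omega>. (norm (x k \<omega> - xh))\<^sup>2))
        \<and> (\<forall>k. (\<integral>\<omega>. (norm (x k \<omega> - xh))\<^sup>2 \<partial>P)
               \<le> (1 - 2 * c) ^ k * (norm (x\<^sub>0 - xh))\<^sup>2 + \<alpha>\<^sup>2 * inverse c * s2)
        \<and> 0 < 1 - 2 * c \<and> 1 - 2 * c < 1"
proof -
  interpret sketched_iteration P A b W M Wk \<alpha> \<beta> x\<^sub>0 j
    using assms unfolding sketched_iteration_def sketched_iteration_axioms_def by blast
  have rho: "0 \<le> spectral_norm meanR" "spectral_norm meanR < 1"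
    using spectral_norm_meanR by (simp_all add: spectral_norm_def onorm_pos_le)
  have "(\<lambda>k. spectral_norm meanR ^ k * norm (x\<^sub>0 - xh)) \<longlonglongrightarrow> 0 * norm (x\<^sub>0 - xh)"
    using rho by (intro tendsto_mult tendsto_const LIMSEQ_power_zero) simp
  then have "(\<lambda>k. (\<integral>\<omega>. x k \<omega> \<partial>P) - xh) \<longlonglongrightarrow> 0"
    by (intro Lim_null_comparison[OF always_eventually[OF allI[OF mean_error_bound]]]) simp
  then have lim: "(\<lambda>k. \<integral>\<omega>. x k \<omega> \<partial>P) \<longlonglongrightarrow> xh"
    by (rule LIM_zero_cancel)
  have int: "integrable P (x k)" for k
    by (rule integrable_continuous_x) (rule continuous_on_id)
  have int_sq: "integrable P (\<lambda>\<omega>. (norm (x k \<omega> - xh))\<^sup>2)" for k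
    by (rule integrable_continuous_x) (intro continuous_intros)
  show ?thesis
    unfolding Let_def mean_damped_inv_eq mean_B_eq
    using lim int int_sq rho(2) mean_error_bound mean_square_error_bound rate_pos rate_less_half by simp
qed

end
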